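(* All free skew Boolean algebras have intersections. That is, for every set $X$, any two elements of the free skew Boolean algebra $\mathbf{SBA}_X$ on $X$ have a greatest lower bound with respect to the natural partial order.
   Context: A skew lattice is an algebra $(S;\wedge,\vee)$ with associative binary operations satisfying $x\wedge(x\vee y)=x=(y\vee x)\wedge x$ and $x\vee(x\wedge y)=x=(y\wedge x)\vee x$. A skew Boolean algebra is an algebra $(S;\wedge,\vee,\setminus,0)$ such that $(S;\wedge,\vee)$ is a skew lattice satisfying $x\wedge(y\vee z)=(x\wedge y)\vee(x\wedge z)$ and $(x\vee y)\wedge z=(x\wedge z)\vee(y\wedge z)$, $0$ satisfies $0\wedge x=0=x\wedge 0$ and $0\vee x=x=x\vee 0$, and $(x\wedge y\wedge x)\vee(x\setminus y)=x$, $(x\wedge y\wedge x)\wedge(x\setminus y)=0=(x\setminus y)\wedge(x\wedge y\wedge x)$. Skew Boolean algebras form a variety. The natural partial order is $x\ge y$ iff $x\wedge y=y=y\wedge x$. A skew lattice has intersections if every pair of elements has a greatest lower bound with respect to the natural partial order. *)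

theory Defs
  imports "HOL-Algebra.Order"
begin

section \<open>Skew lattices and skew Boolean algebras\<close>

record 'a sba = "'a partial_object" +
  smeet :: "'a \<Rightarrow> 'a \<Rightarrow> 'a" (infixl \<open>\<curlywedge>\<index>\<close> 70)
  sjoin :: "'a \<Rightarrow> 'a \<Rightarrow> 'a" (infixl \<open>\<curlyvee>\<index>\<close> 65)
  sdiff :: "'a \<Rightarrow> 'a \<Rightarrow> 'a" (infixl \<open>\<ominus>\<index>\<close> 68)
  szero :: "'a" (\<open>\<zero>\<index>\<close>)

locale skew_lattice =
  fixes S :: "('a, 'm) sba_scheme" (structure)
  assumes meet_closed [simp]: "\<lbrakk>x \<in> carrier S; y \<in> carrier S\<rbrakk> \<Longrightarrow> x \<curlywedge> y \<in> carrier S"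
    and join_closed [simp]: "\<lbrakk>x \<in> carrier S; y \<in> carrier S\<rbrakk> \<Longrightarrow> x \<curlyvee> y \<in> carrier S"
    and meet_assoc: "\<lbrakk>x \<in> carrier S; y \<in> carrier S; z \<in> carrier S\<rbrakk>
          \<Longrightarrow> (x \<curlywedge> y) \<curlywedge> z = x \<curlywedge> (y \<curlywedge> z)"
    and join_assoc: "\<lbrakk>x \<in> carrier S; y \<in> carrier S; z \<in> carrier S\<rbrakk>
          \<Longrightarrow> (x \<curlyvee> y) \<curlyvee> z = x \<curlyvee> (y \<curlyvee> z)"
    and meet_join: "\<lbrakk>x \<in> carrier S; y \<in> carrier S\<rbrakk> \<Longrightarrow> x \<curlywedge> (x \<curlyvee> y) = x"
    and join_meet': "\<lbrakk>x \<in> carrier S; y \<in> carrier S\<rbrakk> \<Longrightarrow> (y \<curlyvee> x) \<curlywedge> x = x"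
    and join_meet: "\<lbrakk>x \<in> carrier S; y \<in> carrier S\<rbrakk> \<Longrightarrow> x \<curlyvee> (x \<curlywedge> y) = x"
    and meet_join': "\<lbrakk>x \<in> carrier S; y \<in> carrier S\<rbrakk> \<Longrightarrow> (y \<curlywedge> x) \<curlyvee> x = x"

locale skew_boolean_algebra = skew_lattice S
  for S :: "('a, 'm) sba_scheme" (structure) +
  assumes diff_closed [simp]: "\<lbrakk>x \<in> carrier S; y \<in> carrier S\<rbrakk> \<Longrightarrow> x \<ominus> y \<in> carrier S"
    and zero_closed [simp]: "\<zero> \<in> carrier S"
    and distrib_left: "\<lbrakk>x \<in> carrier S; y \<in> carrier S; z \<in> carrier S\<rbrakk>
          \<Longrightarrow> x \<curlywedge> (y \<curlyvee> z) = (x \<curlywedge> y) \<curlyvee> (x \<curlywedge> z)"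
    and distrib_right: "\<lbrakk>x \<in> carrier S; y \<in> carrier S; z \<in> carrier S\<rbrakk>
          \<Longrightarrow> (x \<curlyvee> y) \<curlywedge> z = (x \<curlywedge> z) \<curlyvee> (y \<curlywedge> z)"
    and zero_meet: "x \<in> carrier S \<Longrightarrow> \<zero> \<curlywedge> x = \<zero>"
    and meet_zero: "x \<in> carrier S \<Longrightarrow> x \<curlywedge> \<zero> = \<zero>"
    and zero_join: "x \<in> carrier S \<Longrightarrow> \<zero> \<curlyvee> x = x"
    and join_zero: "x \<in> carrier S \<Longrightarrow> x \<curlyvee> \<zero> = x"
    and compl_join: "\<lbrakk>x \<in> carrier S; y \<in> carrier S\<rbrakk>
          \<Longrightarrow> (x \<curlywedge> y \<curlywedge> x) \<curlyvee> (x \<ominus> y) = x"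
    and compl_meet: "\<lbrakk>x \<in> carrier S; y \<in> carrier S\<rbrakk>
          \<Longrightarrow> (x \<curlywedge> y \<curlywedge> x) \<curlywedge> (x \<ominus> y) = \<zero>"
    and compl_meet': "\<lbrakk>x \<in> carrier S; y \<in> carrier S\<rbrakk>
          \<Longrightarrow> (x \<ominus> y) \<curlywedge> (x \<curlywedge> y \<curlywedge> x) = \<zero>"

definition sba_hom :: "('a, 'm) sba_scheme \<Rightarrow> ('b, 'n) sba_scheme \<Rightarrow> ('a \<Rightarrow> 'b) set" where
  "sba_hom S T = {h \<in> carrier S \<rightarrow> carrier T.
     (\<forall>x \<in> carrier S. \<forall>y \<in> carrier S.
        h (x \<curlywedge>\<^bsub>S\<^esub> y) = h x \<curlywedge>\<^bsub>T\<^esub> h y \<and>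
        h (x \<curlyvee>\<^bsub>S\<^esub> y) = h x \<curlyvee>\<^bsub>T\<^esub> h y \<and>
        h (x \<ominus>\<^bsub>S\<^esub> y) = h x \<ominus>\<^bsub>T\<^esub> h y) \<and>
     h \<zero>\<^bsub>S\<^esub> = \<zero>\<^bsub>T\<^esub>}"


section \<open>Natural partial order and intersections\<close>

definition natural_order :: "('a, 'm) sba_scheme \<Rightarrow> 'a gorder" where
  "natural_order S = \<lparr>carrier = carrier S, eq = (=),
     le = (\<lambda>y x. x \<curlywedge>\<^bsub>S\<^esub> y = y \<and> y = y \<curlywedge>\<^bsub>S\<^esub> x)\<rparr>"

definition has_intersections :: "('a, 'm) sba_scheme \<Rightarrow> bool" where
  "has_intersections S \<longleftrightarrow>
     (\<forall>x \<in> carrier S. \<forall>y \<in> carrier S. \<exists>g. is_glb (natural_order S) g {x, y})"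

lemma (in skew_lattice) meet_idem: "x \<in> carrier S \<Longrightarrow> x \<curlywedge> x = x"
  using meet_join[of x "x \<curlywedge> x"] by (simp add: join_meet)

lemma natural_order_simps [simp]:
  "carrier (natural_order S) = carrier S"
  "eq (natural_order S) = (=)"
  "le (natural_order S) y x \<longleftrightarrow> x \<curlywedge>\<^bsub>S\<^esub> y = y \<and> y \<curlywedge>\<^bsub>S\<^esub> x = y"
  by (auto simp only: natural_order_def gorder.simps eq_object.simps partial_object.simps)

lemma (in skew_lattice) natural_order_partial_order: "partial_order (natural_order S)"
proof (intro partial_order.intro weak_partial_order.intro equivalence.intro
    weak_partial_order_axioms.intro partial_order_axioms.intro, unfold natural_order_simps)
  fix x y z
  assume le: "y \<curlywedge> x = x \<and> x \<curlywedge> y = x" "z \<curlywedge> y = y \<and> y \<curlywedge> z = y"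
    and "x \<in> carrier S" "y \<in> carrier S" "z \<in> carrier S"
  then show "z \<curlywedge> x = x \<and> x \<curlywedge> z = x"
    using meet_assoc[of z y x] meet_assoc[of x y z] by simp
next
  fix x y
  assume "y \<curlywedge> x = x \<and> x \<curlywedge> y = x" "x \<curlywedge> y = y \<and> y \<curlywedge> x = y"
  then show "x = y"
    by (elim conjE) (rule subst)
qed (simp_all add: meet_idem)


section \<open>Free skew Boolean algebras\<close>

text \<open>The free algebra of a variety: terms over \<open>X\<close> modulo the identities of the variety.\<close>

datatype 'x sba_term =
    Var 'x
  | Zero
  | Meet "'x sba_term" "'x sba_term"
  | Join "'x sba_term" "'x sba_term"
  | Diff "'x sba_term" "'x sba_term"

definition terms_over :: "'x set \<Rightarrow> 'x sba_term set" where
  "terms_over X = {t. set_sba_term t \<subseteq> X}"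

text \<open>Equational consequence of the axioms of skew Boolean algebras, i.e. the least congruence
  on the term algebra containing all instances of the axioms.\<close>

inductive sba_eq :: "'x sba_term \<Rightarrow> 'x sba_term \<Rightarrow> bool" (infix \<open>\<approx>\<close> 50) where
  refl: "s \<approx> s"
| sym: "s \<approx> t \<Longrightarrow> t \<approx> s"
| trans: "s \<approx> t \<Longrightarrow> t \<approx> u \<Longrightarrow> s \<approx> u"
| cong_Meet: "s \<approx> s' \<Longrightarrow> t \<approx> t' \<Longrightarrow> Meet s t \<approx> Meet s' t'"
| cong_Join: "s \<approx> s' \<Longrightarrow> t \<approx> t' \<Longrightarrow> Join s t \<approx> Join s' t'"
| cong_Diff: "s \<approx> s' \<Longrightarrow> t \<approx> t' \<Longrightarrow> Diff s t \<approx> Diff s' t'"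
| Meet_assoc: "Meet (Meet x y) z \<approx> Meet x (Meet y z)"
| Join_assoc: "Join (Join x y) z \<approx> Join x (Join y z)"
| Meet_Join: "Meet x (Join x y) \<approx> x"
| Join_Meet': "Meet (Join y x) x \<approx> x"
| Join_Meet: "Join x (Meet x y) \<approx> x"
| Meet_Join': "Join (Meet y x) x \<approx> x"
| distrib_l: "Meet x (Join y z) \<approx> Join (Meet x y) (Meet x z)"
| distrib_r: "Meet (Join x y) z \<approx> Join (Meet x z) (Meet y z)"
| Zero_Meet: "Meet Zero x \<approx> Zero"
| Meet_Zero: "Meet x Zero \<approx> Zero"
| Zero_Join: "Join Zero x \<approx> x"
| Join_Zero: "Join x Zero \<approx> x"
| Compl_Join: "Join (Meet (Meet x y) x) (Diff x y) \<approx> x"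
| Compl_Meet: "Meet (Meet (Meet x y) x) (Diff x y) \<approx> Zero"
| Compl_Meet': "Meet (Diff x y) (Meet (Meet x y) x) \<approx> Zero"

text \<open>Derivations may use variables outside \<open>X\<close>; this does not identify more terms over \<open>X\<close>,
  since such variables can be replaced by \<^const>\<open>Zero\<close>
  (cf. the universal property \<open>SBA_universal\<close> below).\<close>

definition sba_rel :: "'x set \<Rightarrow> ('x sba_term \<times> 'x sba_term) set" where
  "sba_rel X = {(s, t). s \<in> terms_over X \<and> t \<in> terms_over X \<and> s \<approx> t}"

definition SBA :: "'x set \<Rightarrow> 'x sba_term set sba" where
  "SBA X = \<lparr>carrier = terms_over X // sba_rel X,
     smeet = (\<lambda>A B. \<Union>s\<in>A. \<Union>t\<in>B. sba_rel X `` {Meet s t}),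
     sjoin = (\<lambda>A B. \<Union>s\<in>A. \<Union>t\<in>B. sba_rel X `` {Join s t}),
     sdiff = (\<lambda>A B. \<Union>s\<in>A. \<Union>t\<in>B. sba_rel X `` {Diff s t}),
     szero = sba_rel X `` {Zero}\<rparr>"

definition SBA_gen :: "'x set \<Rightarrow> 'x \<Rightarrow> 'x sba_term set" where
  "SBA_gen X x = sba_rel X `` {Var x}"

lemma terms_over_simps [simp]:
  "Var x \<in> terms_over X \<longleftrightarrow> x \<in> X"
  "Zero \<in> terms_over X"
  "Meet s t \<in> terms_over X \<longleftrightarrow> s \<in> terms_over X \<and> t \<in> terms_over X"
  "Join s t \<in> terms_over X \<longleftrightarrow> s \<in> terms_over X \<and> t \<in> terms_over X"
  "Diff s t \<in> terms_over X \<longleftrightarrow> s \<in> terms_over X \<and> t \<in> terms_over X"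
  by (auto simp: terms_over_def)

lemma equiv_sba_rel: "equiv (terms_over X) (sba_rel X)"
  by (rule equivI)
    (auto simp: sba_rel_def refl_on_def sym_def trans_def
      intro: sba_eq.refl sba_eq.sym sba_eq.trans)

lemma sba_rel_class_eq:
  "\<lbrakk>s \<in> terms_over X; t \<in> terms_over X\<rbrakk>
    \<Longrightarrow> sba_rel X `` {s} = sba_rel X `` {t} \<longleftrightarrow> s \<approx> t"
  by (subst eq_equiv_class_iff[OF equiv_sba_rel]) (auto simp: sba_rel_def)

lemma carrier_SBA_cases:
  assumes "A \<in> carrier (SBA X)"
  obtains t where "t \<in> terms_over X" "A = sba_rel X `` {t}"
  using assms by (auto simp: SBA_def elim: quotientE)

lemma class_in_carrier_SBA [simp]:
  "t \<in> terms_over X \<Longrightarrow> sba_rel X `` {t} \<in> carrier (SBA X)"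
  by (simp add: SBA_def quotientI)

lemma SBA_op_class:
  assumes "s \<in> terms_over X" "t \<in> terms_over X"
  shows "smeet (SBA X) (sba_rel X `` {s}) (sba_rel X `` {t}) = sba_rel X `` {Meet s t}"
    and "sjoin (SBA X) (sba_rel X `` {s}) (sba_rel X `` {t}) = sba_rel X `` {Join s t}"
    and "sdiff (SBA X) (sba_rel X `` {s}) (sba_rel X `` {t}) = sba_rel X `` {Diff s t}"
proof -
  have *: "(\<Union>a\<in>sba_rel X `` {s}. \<Union>b\<in>sba_rel X `` {t}. sba_rel X `` {F a b})
      = sba_rel X `` {F s t}"
    if cong: "\<And>a a' b b'. a \<approx> a' \<Longrightarrow> b \<approx> b' \<Longrightarrow> F a b \<approx> F a' b'"
      and closed: "\<And>a b. a \<in> terms_over X \<Longrightarrow> b \<in> terms_over X \<Longrightarrow> F a b \<in> terms_over X"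
    for F
  proof (rule UN_equiv_class2[OF equiv_sba_rel equiv_sba_rel _ assms])
    show "congruent2 (sba_rel X) (sba_rel X) (\<lambda>a b. sba_rel X `` {F a b})"
      by (auto simp: congruent2_def sba_rel_class_eq sba_rel_def
          intro: cong closed sba_eq.trans sba_eq.sym)
  qed
  show "smeet (SBA X) (sba_rel X `` {s}) (sba_rel X `` {t}) = sba_rel X `` {Meet s t}"
    by (simp add: SBA_def) (rule *, auto intro: cong_Meet)
  show "sjoin (SBA X) (sba_rel X `` {s}) (sba_rel X `` {t}) = sba_rel X `` {Join s t}"
    by (simp add: SBA_def) (rule *, auto intro: cong_Join)
  show "sdiff (SBA X) (sba_rel X `` {s}) (sba_rel X `` {t}) = sba_rel X `` {Diff s t}"
    by (simp add: SBA_def) (rule *, auto intro: cong_Diff)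
qed

lemma szero_SBA: "szero (SBA X) = sba_rel X `` {Zero}"
  by (simp add: SBA_def)

lemma skew_boolean_algebra_SBA: "skew_boolean_algebra (SBA X)"
  by unfold_locales
    (elim carrier_SBA_cases | simp add: SBA_op_class szero_SBA sba_rel_class_eq sba_eq.intros(7-))+

lemma SBA_gen_closed: "x \<in> X \<Longrightarrow> SBA_gen X x \<in> carrier (SBA X)"
  by (simp add: SBA_gen_def)

primrec term_eval :: "('a, 'm) sba_scheme \<Rightarrow> ('x \<Rightarrow> 'a) \<Rightarrow> 'x sba_term \<Rightarrow> 'a" where
  "term_eval T f (Var x) = f x"
| "term_eval T f Zero = \<zero>\<^bsub>T\<^esub>"
| "term_eval T f (Meet s t) = term_eval T f s \<curlywedge>\<^bsub>T\<^esub> term_eval T f t"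
| "term_eval T f (Join s t) = term_eval T f s \<curlyvee>\<^bsub>T\<^esub> term_eval T f t"
| "term_eval T f (Diff s t) = term_eval T f s \<ominus>\<^bsub>T\<^esub> term_eval T f t"

lemma (in skew_boolean_algebra) term_eval_closed [simp]:
  "(\<And>x. f x \<in> carrier S) \<Longrightarrow> term_eval S f t \<in> carrier S"
  by (induction t) auto

lemma (in skew_boolean_algebra) term_eval_cong:
  assumes "s \<approx> t" and f: "\<And>x. f x \<in> carrier S"
  shows "term_eval S f s = term_eval S f t"
  using assms(1)
  by induction
    (simp_all add: f join_assoc meet_join join_meet' join_meet meet_join'
      zero_meet meet_zero zero_join join_zero compl_join compl_meet compl_meet'
      distrib_left[symmetric] distrib_right[symmetric], simp add: f meet_assoc)

theorem SBA_universal: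
  assumes T: "skew_boolean_algebra T" and f: "f \<in> X \<rightarrow> carrier T"
  shows "\<exists>!h. h \<in> sba_hom (SBA X) T \<and> h \<in> extensional (carrier (SBA X)) \<and>
           (\<forall>x\<in>X. h (SBA_gen X x) = f x)"
proof -
  interpret T: skew_boolean_algebra T by (rule T)
  define f' where "f' x = (if x \<in> X then f x else \<zero>\<^bsub>T\<^esub>)" for x
  have f': "\<And>x. f' x \<in> carrier T"
    using f by (auto simp: f'_def)
  define h where "h = restrict (\<lambda>A. term_eval T f' (SOME t. t \<in> A)) (carrier (SBA X))"
  have h: "h (sba_rel X `` {t}) = term_eval T f' t" if t: "t \<in> terms_over X" for t
  proof -
    have "t \<in> sba_rel X `` {t}"
      using t by (auto simp: sba_rel_def intro: sba_eq.refl)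
    then have "(SOME s. s \<in> sba_rel X `` {t}) \<in> sba_rel X `` {t}"
      by (rule someI)
    then have "t \<approx> (SOME s. s \<in> sba_rel X `` {t})"
      by (auto simp: sba_rel_def)
    then show ?thesis
      using t by (simp add: h_def T.term_eval_cong[OF _ f'])
  qed
  have hom: "h \<in> sba_hom (SBA X) T"
    by (auto simp: sba_hom_def SBA_op_class szero_SBA h f'
        elim!: carrier_SBA_cases)
  show ?thesis
  proof (rule ex1I)
    show "h \<in> sba_hom (SBA X) T \<and> h \<in> extensional (carrier (SBA X)) \<and>
        (\<forall>x\<in>X. h (SBA_gen X x) = f x)"
      using hom by (auto simp: SBA_gen_def h f'_def) (simp add: h_def)
  next
    fix k
    assume k: "k \<in> sba_hom (SBA X) T \<and> k \<in> extensional (carrier (SBA X)) \<and>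
        (\<forall>x\<in>X. k (SBA_gen X x) = f x)"
    have op: "k (smeet (SBA X) A B) = smeet T (k A) (k B)"
        "k (sjoin (SBA X) A B) = sjoin T (k A) (k B)"
        "k (sdiff (SBA X) A B) = sdiff T (k A) (k B)"
      if "A \<in> carrier (SBA X)" "B \<in> carrier (SBA X)" for A B
      using k that by (auto simp: sba_hom_def)
    have "k (sba_rel X `` {t}) = term_eval T f' t" if "t \<in> terms_over X" for t
      using that
    proof (induction t)
      case (Var x)
      then show ?case using k by (auto simp: SBA_gen_def f'_def)
    next
      case Zero
      then show ?case using k by (auto simp: sba_hom_def szero_SBA)
    next
      case (Meet s t)
      then show ?case
        using op(1)[of "sba_rel X `` {s}" "sba_rel X `` {t}"] by (simp add: SBA_op_class)
    next
      case (Join s t)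
      then show ?case
        using op(2)[of "sba_rel X `` {s}" "sba_rel X `` {t}"] by (simp add: SBA_op_class)
    next
      case (Diff s t)
      then show ?case
        using op(3)[of "sba_rel X `` {s}" "sba_rel X `` {t}"] by (simp add: SBA_op_class)
    qed
    then show "k = h"
      using k by (intro extensionalityI[where A = "carrier (SBA X)"])
        (auto simp: h elim!: carrier_SBA_cases, simp add: h_def)
  qed
qed

end

theory Submission
  imports Defs
begin

text \<open>
  Fix a set \<open>\<sigma>\<close> of variables, send the variables outside \<open>\<sigma>\<close> to \<open>0\<close>, and let the variables in
  \<open>\<sigma>\<close> be the diagonal of the rectangular band \<open>\<sigma> \<times> \<sigma>\<close>, which together with \<open>0\<close> is a skew
  Boolean algebra. A term \<open>t\<close> then takes a value \<open>head_tail \<sigma> t\<close> that is either \<open>0\<close> or a pair of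
  variables. These values solve the word problem: \<open>s \<approx> t\<close> holds iff \<open>s\<close> and \<open>t\<close> have the same value
  at every \<open>\<sigma>\<close> (\<open>head_tail_sound\<close>, \<open>head_tail_complete\<close>). Hence \<open>u \<le> v\<close> in the free algebra
  iff at every \<open>\<sigma>\<close> the value of \<open>u\<close> is \<open>0\<close> or the value of \<open>v\<close>. Pointwise this order is that of a
  flat poset with bottom, so the greatest lower bound of \<open>s\<close> and \<open>t\<close> must take their common value
  where they agree and \<open>0\<close> where they differ. Whether they agree at \<open>\<sigma>\<close> depends only on which of
  the finitely many variables of \<open>s\<close> and \<open>t\<close> lie in \<open>\<sigma>\<close>, and cutting \<open>s\<close> down along such a finite
  condition is done by a term (\<open>restrict_term\<close>). This works for infinite \<open>X\<close> too, and the bound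
  uses no new variables.

  For completeness, call \<open>m\<close> a cell for the variables \<open>Y\<close> if each \<open>y \<in> Y\<close> satisfies
  \<open>m \<and> y \<and> m = m\<close> or \<open>m \<and> y = 0\<close>. On a cell, a term acts from the left like the first and from
  the right like the second component of its value (\<open>term_eval_below\<close>). On the other hand, every
  element \<open>m\<close> is \<open>(m \<and> y \<and> m) \<or> (m \<setminus> y)\<close>, so that by distributivity two elements that agree on
  all cells agree everywhere (\<open>agree_on_cells\<close>).
\<close>

section \<open>Orthogonal elements and commuting elements\<close>

context skew_boolean_algebra
begin

text \<open>The square of \<open>b \<and> x \<and> a\<close> contains \<open>a \<and> b\<close>.\<close>

lemma orthogonal_sandwich:
  assumes "a \<curlywedge> b = \<zero>" "a \<in> carrier S" "b \<in> carrier S" "x \<in> carrier S"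
  shows "b \<curlywedge> x \<curlywedge> a = \<zero>"
proof -
  have "b \<curlywedge> x \<curlywedge> a = (b \<curlywedge> x \<curlywedge> a) \<curlywedge> (b \<curlywedge> x \<curlywedge> a)"
    using assms by (simp only: meet_idem meet_closed)
  also have "\<dots> = b \<curlywedge> x \<curlywedge> (a \<curlywedge> b) \<curlywedge> x \<curlywedge> a"
    using assms(2-) by (simp add: meet_assoc)
  finally show ?thesis
    using assms by (simp add: zero_meet meet_zero)
qed

lemma orthogonal_sym:
  assumes "a \<curlywedge> b = \<zero>" "a \<in> carrier S" "b \<in> carrier S"
  shows "b \<curlywedge> a = \<zero>"
  using orthogonal_sandwich[OF assms assms(3)] assms by (simp add: meet_idem)

text \<open>
  Meets below \<open>x\<close> commute: splitting \<open>x\<close> as \<open>z \<or> c\<close> with \<open>c\<close> orthogonal to \<open>z\<close>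
  shows that both \<open>z \<and> y\<close> and \<open>y \<and> z\<close> are equal to \<open>z \<and> y \<and> z\<close>.
\<close>

lemma commute_below:
  assumes [simp]: "x \<in> carrier S" "y \<in> carrier S" "z \<in> carrier S"
    and y: "x \<curlywedge> y = y" "y \<curlywedge> x = y" and z: "x \<curlywedge> z = z" "z \<curlywedge> x = z"
  shows "y \<curlywedge> z = z \<curlywedge> y"
proof -
  define c where "c = x \<ominus> z"
  have [simp]: "c \<in> carrier S" by (simp add: c_def)
  have x: "z \<curlyvee> c = x" and zc: "z \<curlywedge> c = \<zero>" and cz: "c \<curlywedge> z = \<zero>"
    using compl_join[of x z] compl_meet[of x z] compl_meet'[of x z] by (simp_all add: c_def z)
  have "z \<curlywedge> y = z \<curlywedge> (y \<curlywedge> (z \<curlyvee> c))" by (simp add: x y)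
  also have "\<dots> = (z \<curlywedge> y \<curlywedge> z) \<curlyvee> (z \<curlywedge> y \<curlywedge> c)" by (simp add: distrib_left meet_assoc)
  also have "z \<curlywedge> y \<curlywedge> c = \<zero>" using cz by (intro orthogonal_sandwich) auto
  finally have 1: "z \<curlywedge> y = z \<curlywedge> y \<curlywedge> z" by (simp add: join_zero)
  have "y \<curlywedge> z = (z \<curlyvee> c) \<curlywedge> y \<curlywedge> z" by (simp add: x y)
  also have "\<dots> = (z \<curlywedge> y \<curlywedge> z) \<curlyvee> (c \<curlywedge> y \<curlywedge> z)" by (simp add: distrib_right)
  also have "c \<curlywedge> y \<curlywedge> z = \<zero>" using zc by (intro orthogonal_sandwich) auto
  finally show ?thesis using 1 by (simp add: join_zero)
qed

lemma meet_left_idem: "\<lbrakk>x \<in> carrier S; y \<in> carrier S\<rbrakk> \<Longrightarrow> x \<curlywedge> (x \<curlywedge> y) = x \<curlywedge> y"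
  by (simp add: meet_assoc[symmetric] meet_idem)

text \<open>
  Deleting a factor of a product in a band leads to an element above it in the
  \<open>\<D>\<close>-preorder, where \<open>u\<close> is below \<open>v\<close> iff \<open>u \<and> v \<and> u = u\<close>.
\<close>

lemma meet_omit_middle:
  assumes [simp]: "p \<in> carrier S" "q \<in> carrier S" "r \<in> carrier S"
  shows "(p \<curlywedge> q \<curlywedge> r) \<curlywedge> (p \<curlywedge> r) \<curlywedge> (p \<curlywedge> q \<curlywedge> r) = p \<curlywedge> q \<curlywedge> r"
proof -
  have "(p \<curlywedge> q \<curlywedge> r) \<curlywedge> (p \<curlywedge> r) \<curlywedge> (p \<curlywedge> q \<curlywedge> r)
      = p \<curlywedge> q \<curlywedge> ((r \<curlywedge> p) \<curlywedge> (r \<curlywedge> p)) \<curlywedge> q \<curlywedge> r"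
    by (simp only: meet_assoc assms meet_closed)
  also have "\<dots> = p \<curlywedge> q \<curlywedge> (r \<curlywedge> p) \<curlywedge> q \<curlywedge> r"
    by (simp only: meet_idem assms meet_closed)
  also have "\<dots> = (p \<curlywedge> q \<curlywedge> r) \<curlywedge> (p \<curlywedge> q \<curlywedge> r)"
    by (simp only: meet_assoc assms meet_closed)
  finally show ?thesis by (simp add: meet_idem)
qed

section \<open>Acting on an element below\<close>

text \<open>
  If \<open>m\<close> is below \<open>s\<close> and \<open>t\<close> in the \<open>\<D>\<close>-preorder, then on \<open>m\<close> the operations behave as in a
  rectangular band: from the left a meet acts like its first factor and a join like its second
  one, and from the right it is the other way round.
\<close>

context
  fixes m s t
  assumes m [simp]: "m \<in> carrier S" and s [simp]: "s \<in> carrier S" and t [simp]: "t \<in> carrier S"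
    and ms: "m \<curlywedge> s \<curlywedge> m = m" and mt: "m \<curlywedge> t \<curlywedge> m = m"
begin

lemma below_meet: "m \<curlywedge> (s \<curlywedge> t) \<curlywedge> m = m"
proof -
  have "(m \<curlywedge> s) \<curlywedge> m \<curlywedge> (t \<curlywedge> m) = m"
    using ms mt by (simp add: meet_assoc[symmetric])
  then have "m \<curlywedge> ((m \<curlywedge> s) \<curlywedge> (t \<curlywedge> m)) \<curlywedge> m = m"
    using meet_omit_middle[of "m \<curlywedge> s" m "t \<curlywedge> m"] by simp
  then show ?thesis
    by (simp add: meet_assoc meet_left_idem meet_idem)
qed

lemma below_cancel_left: "m \<curlywedge> (s \<curlywedge> (m \<curlywedge> x)) = m \<curlywedge> x" if "x \<in> carrier S"
  using that ms by (simp add: meet_assoc[symmetric])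

lemma below_meet_cancel_left: "m \<curlywedge> (s \<curlywedge> (t \<curlywedge> (m \<curlywedge> x))) = m \<curlywedge> x" if "x \<in> carrier S"
  using that below_meet by (simp add: meet_assoc[symmetric])

text \<open>
  The elements \<open>s \<and> m \<and> s\<close> and \<open>s \<and> t \<and> m \<and> s\<close> lie below \<open>s\<close>, hence commute. Their product in
  one order is the former, in the other order the latter.
\<close>

lemma below_meet_left: "(s \<curlywedge> t) \<curlywedge> m = s \<curlywedge> m"
proof -
  have msm: "m \<curlywedge> (s \<curlywedge> m) = m" using ms by (simp add: meet_assoc)
  have "s \<curlywedge> m \<curlywedge> s = (s \<curlywedge> m \<curlywedge> s) \<curlywedge> (s \<curlywedge> t \<curlywedge> m \<curlywedge> s)"
    by (simp add: meet_assoc meet_left_idem below_meet_cancel_left)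
  also have "\<dots> = (s \<curlywedge> t \<curlywedge> m \<curlywedge> s) \<curlywedge> (s \<curlywedge> m \<curlywedge> s)"
    by (rule commute_below[of s]) (simp_all add: meet_assoc meet_idem meet_left_idem)
  also have "\<dots> = s \<curlywedge> t \<curlywedge> m \<curlywedge> s"
    by (simp add: meet_assoc meet_left_idem below_cancel_left)
  finally have "s \<curlywedge> m \<curlywedge> s \<curlywedge> m = s \<curlywedge> t \<curlywedge> m \<curlywedge> s \<curlywedge> m" by simp
  then show ?thesis by (simp add: meet_assoc msm)
qed

lemma below_meet_right: "m \<curlywedge> (s \<curlywedge> t) = m \<curlywedge> t"
proof -
  have mtm: "m \<curlywedge> (t \<curlywedge> (m \<curlywedge> x)) = m \<curlywedge> x" if "x \<in> carrier S" for x
    using that mt by (simp add: meet_assoc[symmetric])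
  have "t \<curlywedge> m \<curlywedge> t = (t \<curlywedge> m \<curlywedge> s \<curlywedge> t) \<curlywedge> (t \<curlywedge> m \<curlywedge> t)"
    by (simp add: meet_assoc meet_left_idem below_meet_cancel_left)
  also have "\<dots> = (t \<curlywedge> m \<curlywedge> t) \<curlywedge> (t \<curlywedge> m \<curlywedge> s \<curlywedge> t)"
    by (rule commute_below[of t]) (simp_all add: meet_assoc meet_idem meet_left_idem)
  also have "\<dots> = t \<curlywedge> m \<curlywedge> s \<curlywedge> t"
    by (simp add: meet_assoc meet_left_idem mtm)
  finally have "m \<curlywedge> (t \<curlywedge> m \<curlywedge> t) = m \<curlywedge> (t \<curlywedge> m \<curlywedge> s \<curlywedge> t)" by simp
  then show ?thesis by (simp add: meet_assoc mtm)
qed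

text \<open>
  Absorption turns \<open>u \<and> v = u\<close> into \<open>u \<or> v = v\<close>, and here \<open>s \<and> m\<close> and \<open>t \<and> m\<close> are such a pair.
\<close>

lemma below_join_left: "(s \<curlyvee> t) \<curlywedge> m = t \<curlywedge> m"
proof -
  have "s \<curlywedge> m = (s \<curlywedge> m) \<curlywedge> (t \<curlywedge> m)"
    using mt by (simp add: meet_assoc)
  with meet_join'[of "t \<curlywedge> m" "s \<curlywedge> m"] show ?thesis by (simp add: distrib_right)
qed

lemma below_join_right: "m \<curlywedge> (s \<curlyvee> t) = m \<curlywedge> s"
proof -
  have "m \<curlywedge> t = (m \<curlywedge> s) \<curlywedge> (m \<curlywedge> t)"
    by (simp add: meet_assoc below_cancel_left)
  with join_meet[of "m \<curlywedge> s" "m \<curlywedge> t"] show ?thesis by (simp add: distrib_left)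
qed

end

text \<open>
  The product \<open>s \<and> t \<and> s\<close> is above \<open>m\<close>, and \<open>s \<setminus> t\<close> is orthogonal to it.
\<close>

lemma below_diff:
  assumes [simp]: "m \<in> carrier S" "s \<in> carrier S" "t \<in> carrier S"
    and "m \<curlywedge> s \<curlywedge> m = m" "m \<curlywedge> t \<curlywedge> m = m"
  shows "(s \<ominus> t) \<curlywedge> m = \<zero>"
proof -
  define d k where "d = s \<ominus> t" and "k = s \<curlywedge> t \<curlywedge> s"
  have [simp]: "d \<in> carrier S" "k \<in> carrier S" by (simp_all add: d_def k_def)
  have "m \<curlywedge> k \<curlywedge> m = m"
    unfolding k_def using assms by (intro below_meet) auto
  moreover have "d \<curlywedge> m \<curlywedge> k = \<zero>"
    using compl_meet[of s t] by (intro orthogonal_sandwich) (auto simp: d_def k_def)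
  then have "d \<curlywedge> (m \<curlywedge> k \<curlywedge> m) = \<zero>"
    by (simp add: meet_assoc[symmetric] zero_meet)
  ultimately show ?thesis by (simp add: d_def)
qed

lemma diff_below:
  assumes [simp]: "s \<in> carrier S" "t \<in> carrier S"
  shows "s \<curlywedge> (s \<ominus> t) = s \<ominus> t" "(s \<ominus> t) \<curlywedge> s = s \<ominus> t"
proof -
  show "s \<curlywedge> (s \<ominus> t) = s \<ominus> t"
    using join_meet'[of "s \<ominus> t" "s \<curlywedge> t \<curlywedge> s"] by (simp add: compl_join)
  have "(s \<ominus> t) \<curlywedge> ((s \<curlywedge> t \<curlywedge> s) \<curlyvee> (s \<ominus> t)) = s \<ominus> t"
    by (subst distrib_left) (simp_all add: compl_meet' zero_join meet_idem)
  then show "(s \<ominus> t) \<curlywedge> s = s \<ominus> t" by (simp add: compl_join)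
qed

lemma diff_orthogonal:
  assumes [simp]: "m \<in> carrier S" "s \<in> carrier S" "t \<in> carrier S" and mt: "m \<curlywedge> t = \<zero>"
  shows "(s \<ominus> t) \<curlywedge> m = s \<curlywedge> m" "m \<curlywedge> (s \<ominus> t) = m \<curlywedge> s"
proof -
  have tm: "t \<curlywedge> m = \<zero>" using mt by (rule orthogonal_sym) auto
  have "t \<curlywedge> s \<curlywedge> m = \<zero>" "m \<curlywedge> s \<curlywedge> t = \<zero>"
    using mt tm by (auto intro: orthogonal_sandwich)
  then have "(s \<curlywedge> t \<curlywedge> s) \<curlywedge> m = \<zero>" "m \<curlywedge> (s \<curlywedge> t \<curlywedge> s) = \<zero>"
    by (simp_all add: meet_assoc meet_zero) (simp add: meet_assoc[symmetric] zero_meet)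
  then show "(s \<ominus> t) \<curlywedge> m = s \<curlywedge> m" "m \<curlywedge> (s \<ominus> t) = m \<curlywedge> s"
    using distrib_right[of "s \<curlywedge> t \<curlywedge> s" "s \<ominus> t" m] distrib_left[of m "s \<curlywedge> t \<curlywedge> s" "s \<ominus> t"]
    by (simp_all add: compl_join zero_join)
qed

end

section \<open>Values of terms in rectangular bands with zero\<close>

text \<open>
  The components of a meet come from the first factor on the left and the second one on the right,
  those of a join the other way round: in a rectangular band \<open>x \<or> y = y \<and> x\<close>. The zero is
  \<^const>\<open>None\<close>.
\<close>

definition rectangular_sba :: "('a \<times> 'a) option sba" where
  "rectangular_sba = \<lparr>carrier = UNIV,
     smeet = (\<lambda>u v. case (u, v) of (Some (a, b), Some (c, d)) \<Rightarrow> Some (a, d) | _ \<Rightarrow> None),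
     sjoin = (\<lambda>u v. case (u, v) of (None, w) \<Rightarrow> w | (Some p, None) \<Rightarrow> Some p
       | (Some (a, b), Some (c, d)) \<Rightarrow> Some (c, b)),
     sdiff = (\<lambda>u v. if v = None then u else None),
     szero = None\<rparr>"

lemma skew_boolean_algebra_rectangular: "skew_boolean_algebra rectangular_sba"
  by unfold_locales (auto simp: rectangular_sba_def split: option.splits)

definition head_tail :: "'x set \<Rightarrow> 'x sba_term \<Rightarrow> ('x \<times> 'x) option" where
  "head_tail \<sigma> = term_eval rectangular_sba (\<lambda>x. if x \<in> \<sigma> then Some (x, x) else None)"

lemma head_tail_simps [simp]:
  "head_tail \<sigma> (Var x) = (if x \<in> \<sigma> then Some (x, x) else None)"
  "head_tail \<sigma> Zero = None"
  "head_tail \<sigma> (Meet s t) = (case (head_tail \<sigma> s, head_tail \<sigma> t) of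
     (Some (a, b), Some (c, d)) \<Rightarrow> Some (a, d) | _ \<Rightarrow> None)"
  "head_tail \<sigma> (Join s t) = (case (head_tail \<sigma> s, head_tail \<sigma> t) of
     (None, w) \<Rightarrow> w | (Some p, None) \<Rightarrow> Some p
     | (Some (a, b), Some (c, d)) \<Rightarrow> Some (c, b))"
  "head_tail \<sigma> (Diff s t) = (if head_tail \<sigma> t = None then head_tail \<sigma> s else None)"
  by (simp_all add: head_tail_def rectangular_sba_def)

lemma head_tail_sound: "s \<approx> t \<Longrightarrow> head_tail \<sigma> s = head_tail \<sigma> t"
  unfolding head_tail_def
  by (rule skew_boolean_algebra.term_eval_cong[OF skew_boolean_algebra_rectangular])
    (simp_all add: rectangular_sba_def)

lemma head_tail_restrict:
  "set_sba_term t \<subseteq> Y \<Longrightarrow> head_tail (\<sigma> \<inter> Y) t = head_tail \<sigma> t"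
  by (induction t) (auto simp: subset_iff)

section \<open>Completeness of the values\<close>

text \<open>
  For each variable of the term, \<open>\<sigma>\<close> records which of the two alternatives for the cell \<open>m\<close>
  holds. That \<open>m\<close> is below the value of the term
  is carried along because the rules for acting on an element below require it.
\<close>

lemma (in skew_boolean_algebra) term_eval_below:
  assumes [simp]: "m \<in> carrier S" and f [simp]: "\<And>x. f x \<in> carrier S"
    and "\<And>x. x \<in> set_sba_term t \<Longrightarrow> x \<in> \<sigma> \<Longrightarrow> m \<curlywedge> f x \<curlywedge> m = m"
    and "\<And>x. x \<in> set_sba_term t \<Longrightarrow> x \<notin> \<sigma> \<Longrightarrow> m \<curlywedge> f x = \<zero>"
  shows "case head_tail \<sigma> t of
      None \<Rightarrow> term_eval S f t \<curlywedge> m = \<zero> \<and> m \<curlywedge> term_eval S f t = \<zero>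
    | Some (a, b) \<Rightarrow> m \<curlywedge> term_eval S f t \<curlywedge> m = m \<and>
        term_eval S f t \<curlywedge> m = f a \<curlywedge> m \<and> m \<curlywedge> term_eval S f t = m \<curlywedge> f b"
    (is "?P t")
  using assms(3,4)
proof (induction t)
  case (Var x)
  then show ?case by (auto intro: orthogonal_sym)
next
  case Zero
  then show ?case by (simp add: zero_meet meet_zero)
next
  case (Meet s t)
  let ?s = "term_eval S f s" and ?t = "term_eval S f t"
  have *: "(?s \<curlywedge> ?t) \<curlywedge> m = \<zero> \<and> m \<curlywedge> (?s \<curlywedge> ?t) = \<zero>"
    if "m \<curlywedge> ?s = \<zero> \<or> ?t \<curlywedge> m = \<zero>"
  proof -
    have "?s \<curlywedge> ?t \<curlywedge> m = \<zero>"
      using that orthogonal_sandwich[of m ?s ?t] by (auto simp: meet_assoc meet_zero)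
    then show ?thesis by (auto intro: orthogonal_sym)
  qed
  have IH: "?P s" "?P t" using Meet by simp_all
  show ?case
  proof (cases "head_tail \<sigma> s = None \<or> head_tail \<sigma> t = None")
    case True
    then show ?thesis using IH * by (auto split: option.splits)
  next
    case False
    then obtain a b c d where ht: "head_tail \<sigma> s = Some (a, b)" "head_tail \<sigma> t = Some (c, d)"
      by auto
    have "m \<curlywedge> ?s \<curlywedge> m = m" "m \<curlywedge> ?t \<curlywedge> m = m" "?s \<curlywedge> m = f a \<curlywedge> m" "m \<curlywedge> ?t = m \<curlywedge> f d"
      using IH unfolding ht option.case prod.case by blast+
    with below_meet[of m ?s ?t] below_meet_left[of m ?s ?t] below_meet_right[of m ?s ?t]
    show ?thesis by (simp add: ht)
  qed
next
  case (Join s t)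
  let ?s = "term_eval S f s" and ?t = "term_eval S f t"
  have "m \<curlywedge> (?s \<curlyvee> ?t) \<curlywedge> m = (m \<curlywedge> ?s \<curlywedge> m) \<curlyvee> (m \<curlywedge> ?t \<curlywedge> m)"
    by (simp add: distrib_left distrib_right)
  moreover have "m \<curlyvee> m = m"
    using join_meet[of m m] by (simp add: meet_idem)
  ultimately show ?case
    using Join below_join_left[of m ?s ?t] below_join_right[of m ?s ?t]
    by (auto simp: distrib_left distrib_right zero_join join_zero zero_meet split: option.splits)
next
  case (Diff s t)
  let ?s = "term_eval S f s" and ?t = "term_eval S f t"
  have *: "(?s \<ominus> ?t) \<curlywedge> m = \<zero> \<and> m \<curlywedge> (?s \<ominus> ?t) = \<zero>"
    if "(?s \<ominus> ?t) \<curlywedge> m = \<zero> \<or> ?s \<curlywedge> m = \<zero>"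
  proof -
    have "(?s \<ominus> ?t) \<curlywedge> m = ((?s \<ominus> ?t) \<curlywedge> ?s) \<curlywedge> m" by (simp add: diff_below)
    with that have "(?s \<ominus> ?t) \<curlywedge> m = \<zero>" by (auto simp: meet_assoc meet_zero)
    then show ?thesis by (auto intro: orthogonal_sym)
  qed
  have IH: "?P s" "?P t" using Diff by simp_all
  show ?case
  proof (cases "head_tail \<sigma> t")
    case None
    with IH diff_orthogonal[of m ?s ?t] show ?thesis
      by (auto simp: diff_orthogonal split: option.splits)
  next
    case (Some p)
    then have "m \<curlywedge> ?t \<curlywedge> m = m" using IH(2) by (auto split: prod.splits)
    moreover have "?s \<curlywedge> m = \<zero> \<or> m \<curlywedge> ?s \<curlywedge> m = m" using IH(1) by (auto split: option.splits)
    ultimately have "(?s \<ominus> ?t) \<curlywedge> m = \<zero> \<and> m \<curlywedge> (?s \<ominus> ?t) = \<zero>"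
      using below_diff[of m ?s ?t] * by auto
    with Some show ?thesis by simp
  qed
qed

text \<open>
  Induction on \<open>Y\<close>: a cell for \<open>Y\<close> is the join of two cells for \<open>insert y Y\<close>, and for
  \<open>Y = {}\<close> every element is a cell. Elements that agree as factors everywhere are equal, by
  idempotence.
\<close>

lemma (in skew_boolean_algebra) agree_on_cells:
  assumes "finite Y" and [simp]: "\<And>y. y \<in> Y \<Longrightarrow> f y \<in> carrier S" "a \<in> carrier S" "b \<in> carrier S"
    and "\<And>m. m \<in> carrier S \<Longrightarrow> \<forall>y\<in>Y. m \<curlywedge> f y \<curlywedge> m = m \<or> m \<curlywedge> f y = \<zero> \<Longrightarrow>
        a \<curlywedge> m = b \<curlywedge> m \<and> m \<curlywedge> a = m \<curlywedge> b"
  shows "a = b"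
proof -
  have "a \<curlywedge> m = b \<curlywedge> m \<and> m \<curlywedge> a = m \<curlywedge> b" if "m \<in> carrier S" for m
    using assms(1,2,5) that
  proof (induction Y arbitrary: m)
    case empty
    then show ?case by simp
  next
    case (insert y Y)
    have [simp]: "f z \<in> carrier S" if "z \<in> insert y Y" for z
      using that by (rule insert.prems)
    show ?case
    proof (rule insert.IH)
      fix m
      assume [simp]: "m \<in> carrier S"
        and cell: "\<forall>z\<in>Y. m \<curlywedge> f z \<curlywedge> m = m \<or> m \<curlywedge> f z = \<zero>"
      \<comment> \<open>everything below a cell is a cell\<close>
      have sub: "n \<curlywedge> f z \<curlywedge> n = n \<or> n \<curlywedge> f z = \<zero>"
        if [simp]: "n \<in> carrier S" and n: "m \<curlywedge> n = n" "n \<curlywedge> m = n" and z: "z \<in> Y" for n z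
      proof -
        have [simp]: "f z \<in> carrier S" using z by simp
        have "n \<curlywedge> f z = n \<curlywedge> (m \<curlywedge> f z)" "n \<curlywedge> f z \<curlywedge> n = n \<curlywedge> (m \<curlywedge> f z \<curlywedge> m) \<curlywedge> n"
          using n by (simp_all add: meet_assoc) (simp_all add: meet_assoc[symmetric])
        then show ?thesis
          using cell z n by (auto simp: meet_zero meet_idem)
      qed
      define p where "p = m \<curlywedge> f y \<curlywedge> m"
      define q where "q = m \<ominus> f y"
      have pq [simp]: "p \<in> carrier S" "q \<in> carrier S" by (simp_all add: p_def q_def)
      have m: "p \<curlyvee> q = m" by (simp add: p_def q_def compl_join)
      have p: "a \<curlywedge> p = b \<curlywedge> p \<and> p \<curlywedge> a = p \<curlywedge> b"
      proof (rule insert.prems)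
        have "p \<curlywedge> f y \<curlywedge> p = p"
          using meet_idem[of p] by (simp add: p_def meet_assoc meet_left_idem)
        moreover have "m \<curlywedge> p = p" "p \<curlywedge> m = p"
          by (simp_all add: p_def meet_assoc meet_left_idem meet_idem)
        ultimately show "\<forall>z\<in>insert y Y. p \<curlywedge> f z \<curlywedge> p = p \<or> p \<curlywedge> f z = \<zero>"
          using sub[of p] by auto
      qed simp
      have q: "a \<curlywedge> q = b \<curlywedge> q \<and> q \<curlywedge> a = q \<curlywedge> b"
      proof (rule insert.prems)
        have qm: "q \<curlywedge> m = q" "m \<curlywedge> q = q" by (simp_all add: q_def diff_below)
        have "q \<curlywedge> p = \<zero>" by (simp add: p_def q_def compl_meet')
        then have "q \<curlywedge> (m \<curlywedge> f y \<curlywedge> m) \<curlywedge> q = \<zero>" by (simp add: p_def zero_meet)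
        then have "q \<curlywedge> m \<curlywedge> f y \<curlywedge> (m \<curlywedge> q) = \<zero>" by (simp add: meet_assoc)
        then have "q \<curlywedge> f y \<curlywedge> q = \<zero>" by (simp add: qm)
        then have "(q \<curlywedge> f y) \<curlywedge> (q \<curlywedge> f y) = \<zero>"
          by (simp add: meet_assoc[symmetric] zero_meet)
        then have "q \<curlywedge> f y = \<zero>" by (simp add: meet_idem)
        then show "\<forall>z\<in>insert y Y. q \<curlywedge> f z \<curlywedge> q = q \<or> q \<curlywedge> f z = \<zero>"
          using qm sub[of q] by auto
      qed simp
      show "a \<curlywedge> m = b \<curlywedge> m \<and> m \<curlywedge> a = m \<curlywedge> b"
        unfolding m[symmetric] using p q by (simp add: distrib_left distrib_right)
    qed (use insert.prems in auto)
  qed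
  from this[of a] this[of b] show "a = b" by (simp add: meet_idem)
qed

text \<open>
  Both terms are evaluated in the free algebra on all variables, where the value of a term is its
  class.
\<close>

lemma head_tail_complete:
  assumes "\<And>\<sigma>. head_tail \<sigma> s = head_tail \<sigma> t"
  shows "s \<approx> t"
proof -
  let ?S = "SBA (UNIV :: 'a set)"
  interpret skew_boolean_algebra ?S by (rule skew_boolean_algebra_SBA)
  have f: "SBA_gen UNIV x \<in> carrier ?S" for x :: 'a
    by (simp add: SBA_gen_closed)
  have U: "u \<in> terms_over UNIV" for u :: "'a sba_term"
    by (simp add: terms_over_def)
  have eval: "term_eval ?S (SBA_gen UNIV) u = sba_rel UNIV `` {u}" for u :: "'a sba_term"
    by (induction u) (simp_all add: SBA_gen_def SBA_op_class szero_SBA U)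
  let ?Y = "set_sba_term s \<union> set_sba_term t"
  have "term_eval ?S (SBA_gen UNIV) s = term_eval ?S (SBA_gen UNIV) t"
  proof (rule agree_on_cells[of ?Y "SBA_gen UNIV"])
    fix m
    assume m: "m \<in> carrier ?S"
      and cell: "\<forall>y\<in>?Y. m \<curlywedge>\<^bsub>?S\<^esub> SBA_gen UNIV y \<curlywedge>\<^bsub>?S\<^esub> m = m \<or> m \<curlywedge>\<^bsub>?S\<^esub> SBA_gen UNIV y = \<zero>\<^bsub>?S\<^esub>"
    define \<sigma> where "\<sigma> = {y. m \<curlywedge>\<^bsub>?S\<^esub> SBA_gen UNIV y \<curlywedge>\<^bsub>?S\<^esub> m = m}"
    have "case head_tail \<sigma> u of
      None \<Rightarrow> term_eval ?S (SBA_gen UNIV) u \<curlywedge>\<^bsub>?S\<^esub> m = \<zero>\<^bsub>?S\<^esub> \<and> m \<curlywedge>\<^bsub>?S\<^esub> term_eval ?S (SBA_gen UNIV) u = \<zero>\<^bsub>?S\<^esub>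
    | Some (a, b) \<Rightarrow> m \<curlywedge>\<^bsub>?S\<^esub> term_eval ?S (SBA_gen UNIV) u \<curlywedge>\<^bsub>?S\<^esub> m = m \<and>
        term_eval ?S (SBA_gen UNIV) u \<curlywedge>\<^bsub>?S\<^esub> m = SBA_gen UNIV a \<curlywedge>\<^bsub>?S\<^esub> m \<and>
        m \<curlywedge>\<^bsub>?S\<^esub> term_eval ?S (SBA_gen UNIV) u = m \<curlywedge>\<^bsub>?S\<^esub> SBA_gen UNIV b"
      if "u \<in> {s, t}" for u
      using m f cell that by (intro term_eval_below) (auto simp: \<sigma>_def)
    from this[of s] this[of t] assms[of \<sigma>]
    show "term_eval ?S (SBA_gen UNIV) s \<curlywedge>\<^bsub>?S\<^esub> m = term_eval ?S (SBA_gen UNIV) t \<curlywedge>\<^bsub>?S\<^esub> m \<and>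
        m \<curlywedge>\<^bsub>?S\<^esub> term_eval ?S (SBA_gen UNIV) s = m \<curlywedge>\<^bsub>?S\<^esub> term_eval ?S (SBA_gen UNIV) t"
      by (auto split: option.splits)
  qed (auto simp: f)
  then show ?thesis
    using U by (simp add: eval sba_rel_class_eq)
qed

section \<open>Greatest lower bounds\<close>

text \<open>
  Shannon expansion: for a further variable \<open>y\<close>, the required term is the part inside \<open>y\<close> of a
  term for the case \<open>y \<in> \<sigma>\<close>, joined with the part outside \<open>y\<close> of a term for the case \<open>y \<notin> \<sigma>\<close>.
\<close>

lemma restrict_term:
  assumes "finite Y"
  shows "\<exists>g. set_sba_term g \<subseteq> set_sba_term s \<union> Y \<and>
    (\<forall>\<sigma>. head_tail \<sigma> g = (if P (\<sigma> \<inter> Y) then head_tail \<sigma> s else None))"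
  using assms
proof (induction Y arbitrary: P)
  case empty
  show ?case
    by (cases "P {}") (auto intro: exI[of _ s] exI[of _ Zero])
next
  case (insert y Y)
  obtain g1 where g1: "set_sba_term g1 \<subseteq> set_sba_term s \<union> Y"
    "\<And>\<sigma>. head_tail \<sigma> g1 = (if P (insert y (\<sigma> \<inter> Y)) then head_tail \<sigma> s else None)"
    using insert.IH[of "\<lambda>\<tau>. P (insert y \<tau>)"] by blast
  obtain g0 where g0: "set_sba_term g0 \<subseteq> set_sba_term s \<union> Y"
    "\<And>\<sigma>. head_tail \<sigma> g0 = (if P (\<sigma> \<inter> Y) then head_tail \<sigma> s else None)"
    using insert.IH[of P] by blast
  show ?case
    by (rule exI[of _ "Join (Meet (Meet g1 (Var y)) g1) (Diff g0 (Var y))"])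
      (use g0 g1 in \<open>auto simp: Int_insert_right split: option.splits\<close>)
qed

theorem corollary6p5:
  fixes X :: "'x set"
  shows "has_intersections (SBA X)"
  unfolding has_intersections_def
proof (intro ballI)
  fix A B
  assume "A \<in> carrier (SBA X)" "B \<in> carrier (SBA X)"
  then obtain s t where s: "s \<in> terms_over X" "A = sba_rel X `` {s}"
    and t: "t \<in> terms_over X" "B = sba_rel X `` {t}"
    by (elim carrier_SBA_cases) blast
  let ?Y = "set_sba_term s \<union> set_sba_term t"
  have "finite (set_sba_term u)" for u :: "'x sba_term" by (induction u) auto
  then have "finite ?Y" by simp
  from restrict_term[OF this, of s "\<lambda>\<tau>. head_tail \<tau> s = head_tail \<tau> t"]
  obtain g where g: "g \<in> terms_over X"
    and ht: "\<And>\<sigma>. head_tail \<sigma> g = (if head_tail \<sigma> s = head_tail \<sigma> t then head_tail \<sigma> s else None)"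
    using s(1) t(1) by (auto simp: terms_over_def head_tail_restrict)
  have le: "le (natural_order (SBA X)) (sba_rel X `` {u}) (sba_rel X `` {v})
      \<longleftrightarrow> (\<forall>\<sigma>. head_tail \<sigma> u = None \<or> head_tail \<sigma> u = head_tail \<sigma> v)"
    if "u \<in> terms_over X" "v \<in> terms_over X" for u v
  proof -
    have "le (natural_order (SBA X)) (sba_rel X `` {u}) (sba_rel X `` {v})
      \<longleftrightarrow> Meet v u \<approx> u \<and> Meet u v \<approx> u"
      using that by (simp add: SBA_op_class sba_rel_class_eq)
    also have "\<dots> \<longleftrightarrow> (\<forall>\<sigma>. head_tail \<sigma> (Meet v u) = head_tail \<sigma> u \<and> head_tail \<sigma> (Meet u v) = head_tail \<sigma> u)"
      by (blast intro: head_tail_complete head_tail_sound)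
    also have "\<dots> \<longleftrightarrow> (\<forall>\<sigma>. head_tail \<sigma> u = None \<or> head_tail \<sigma> u = head_tail \<sigma> v)"
      by (intro all_cong1) (auto split: option.splits)
    finally show ?thesis .
  qed
  have "is_glb (natural_order (SBA X)) (sba_rel X `` {g}) {A, B}"
  proof (rule greatest_LowerI)
    fix C
    assume "C \<in> {A, B}"
    then show "le (natural_order (SBA X)) (sba_rel X `` {g}) C"
      using s t g by (auto simp only: le) (auto simp: ht)
  next
    fix C
    assume C: "C \<in> Lower (natural_order (SBA X)) {A, B}"
    then obtain u where u: "u \<in> terms_over X" "C = sba_rel X `` {u}"
      by (auto simp only: Lower_def natural_order_simps elim: carrier_SBA_cases)
    have "A \<in> carrier (natural_order (SBA X))" "B \<in> carrier (natural_order (SBA X))"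
      using s t by simp_all
    with C have "le (natural_order (SBA X)) C A" "le (natural_order (SBA X)) C B"
      unfolding Lower_def by blast+
    then have "head_tail \<sigma> u = None \<or> head_tail \<sigma> u = head_tail \<sigma> s"
      "head_tail \<sigma> u = None \<or> head_tail \<sigma> u = head_tail \<sigma> t" for \<sigma>
      unfolding s t u le[OF u(1) s(1)] le[OF u(1) t(1)] by blast+
    then have "head_tail \<sigma> u = None \<or> head_tail \<sigma> u = head_tail \<sigma> g" for \<sigma>
      unfolding ht by (metis (full_types))
    then show "le (natural_order (SBA X)) C (sba_rel X `` {g})"
      unfolding u(2) le[OF u(1) g] by blast
  qed (use s t g in auto)
  then show "\<exists>g. is_glb (natural_order (SBA X)) g {A, B}" ..
qed

end
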